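(* Define integers $f(n)$ by \[ \sum_{n=0}^{\infty}f(n)q^n=\prod_{i\ge 1}\frac{1+q^{2i-1}}{(1-q^{4i})(1+q^{4i-2})^2}. \] Then for every $n\ge 0$, $f(n)$ equals the number of partitions of $n$ with an even number of even hooks minus the number of partitions of $n$ with an odd number of even hooks.
   Context: For a cell $(i,j)$ of the Young diagram of a partition $\lambda$ (with conjugate $\lambda'$), its hook length is $\lambda_i-j+\lambda'_j-i+1$. An even hook is a cell whose hook length is even; the number of even hooks of $\lambda$ is the number of such cells. *)

theory Defs
  imports "HOL-Analysis.Analysis" "HOL-Computational_Algebra.Formal_Power_Series"
begin

definition partition_of :: "nat list \<Rightarrow> nat \<Rightarrow> bool" where
  "partition_of xs n \<longleftrightarrow> sorted_wrt (\<ge>) xs \<and> (\<forall>x\<in>set xs. 0 < x) \<and> sum_list xs = n"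

text \<open>Rows and columns are numbered from 1, so the \<open>i\<close>-th part is \<open>xs ! (i - 1)\<close>.\<close>

definition part :: "nat list \<Rightarrow> nat \<Rightarrow> nat" where
  "part xs i = (if 1 \<le> i \<and> i \<le> length xs then xs ! (i - 1) else 0)"

definition conj_part :: "nat list \<Rightarrow> nat \<Rightarrow> nat" where
  "conj_part xs j = card {i. 1 \<le> i \<and> i \<le> length xs \<and> j \<le> part xs i}"

definition young_diagram :: "nat list \<Rightarrow> (nat \<times> nat) set" where
  "young_diagram xs = {(i, j). 1 \<le> i \<and> i \<le> length xs \<and> 1 \<le> j \<and> j \<le> part xs i}"

text \<open>Integer-valued, so that no subtraction is truncated.\<close>

definition hook_length :: "nat list \<Rightarrow> nat \<times> nat \<Rightarrow> int" where
  "hook_length xs = (\<lambda>(i, j). int (part xs i) - int j + int (conj_part xs j) - int i + 1)"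

definition num_even_hooks :: "nat list \<Rightarrow> nat" where
  "num_even_hooks xs = card {c \<in> young_diagram xs. even (hook_length xs c)}"

text \<open>
  Division of formal power series in the library needs a field of coefficients, hence \<open>rat\<close>.
  The exponents are meant for \<open>i \<ge> 1\<close>.
\<close>

definition gf_factor :: "nat \<Rightarrow> rat fps" where
  "gf_factor i =
     (1 + fps_X ^ (2 * i - 1)) / ((1 - fps_X ^ (4 * i)) * (1 + fps_X ^ (4 * i - 2)) ^ 2)"

text \<open>
  The product converges in the topology of formal power series (coefficientwise stabilisation),
  and its coefficients are integers; so requiring it to equal a series with coefficients \<open>f\<close> determines exactly one
  integer sequence.
\<close>

lemma gf_factor_int:
  assumes "i \<ge> 1"
  obtains A :: "int fps" where "gf_factor i = Abs_fps (\<lambda>m. of_int (fps_nth A m))"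
    and "fps_X ^ i dvd A - 1"
proof -
  define h :: "int fps \<Rightarrow> rat fps" where "h = (\<lambda>A. Abs_fps (\<lambda>m. of_int (fps_nth A m)))"
  have h_add: "h (A + B) = h A + h B" for A B
    by (simp add: h_def fps_eq_iff)
  have h_diff: "h (A - B) = h A - h B" for A B
    by (simp add: h_def fps_eq_iff)
  have h_mult: "h (A * B) = h A * h B" for A B
    by (simp add: h_def fps_eq_iff fps_mult_nth)
  have h_1: "h 1 = 1"
    by (simp add: h_def fps_eq_iff)
  have h_X: "h (fps_X ^ k) = fps_X ^ k" for k
    by (simp add: h_def fps_eq_iff fps_X_power_iff)
  define N :: "int fps" where "N = 1 + fps_X ^ (2 * i - 1)"
  define D :: "int fps" where "D = (1 - fps_X ^ (4 * i)) * (1 + fps_X ^ (4 * i - 2)) ^ 2"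
  define R where "R = fps_right_inverse D 1"
  have D0: "fps_nth D 0 = 1"
    using assms by (simp add: D_def power2_eq_square fps_X_power_iff)
  have DR: "D * R = 1"
    unfolding R_def by (rule fps_right_inverse) (simp add: D0)
  have hDR: "h D * h R = 1"
    by (metis DR h_1 h_mult)
  have "gf_factor i = h N / h D"
    by (simp add: gf_factor_def N_def D_def h_add h_diff h_mult h_1 h_X power2_eq_square)
  also have "\<dots> = h N * h R"
  proof -
    have "h N * h R * h D = h N"
      using hDR by (metis mult.assoc mult.commute mult.right_neutral)
    moreover have "h D \<noteq> 0"
      using hDR by auto
    ultimately show ?thesis
      by (metis nonzero_mult_div_cancel_right)
  qed
  finally have *: "gf_factor i = h (N * R)"
    by (simp add: h_mult)
  have X: "fps_X ^ i dvd (fps_X ^ k :: int fps)" if "k \<ge> i" for k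
    using that by (rule le_imp_power_dvd)
  have N1: "fps_X ^ i dvd N - 1"
    using X[of "2 * i - 1"] assms by (simp add: N_def)
  have "D - 1 = fps_X ^ (4 * i - 2) * (2 + fps_X ^ (4 * i - 2))
                - fps_X ^ (4 * i) * (1 + fps_X ^ (4 * i - 2)) ^ 2"
    by (simp add: D_def algebra_simps power2_eq_square)
  moreover have "fps_X ^ i dvd fps_X ^ (4 * i - 2) * (2 + fps_X ^ (4 * i - 2) :: int fps)"
    by (rule dvd_mult2, rule X) (use assms in linarith)
  moreover have "fps_X ^ i dvd fps_X ^ (4 * i) * (1 + fps_X ^ (4 * i - 2) :: int fps) ^ 2"
    by (rule dvd_mult2, rule X) simp
  ultimately have D1: "fps_X ^ i dvd D - 1"
    by (metis dvd_diff)
  have "N * R - 1 = (N - 1) * R - (D - 1) * R"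
    using DR by (simp add: algebra_simps)
  then have "fps_X ^ i dvd N * R - 1"
    using N1 D1 by (metis dvd_diff dvd_mult2)
  then show ?thesis
    using * unfolding h_def by (intro that[of "N * R"])
qed

lemma ex1_gf_coefficients:
  "\<exists>!f :: nat \<Rightarrow> int. (\<lambda>k. gf_factor (k + 1)) has_prod Abs_fps (\<lambda>m. of_int (f m))"
proof -
  define h :: "int fps \<Rightarrow> rat fps" where "h = (\<lambda>A. Abs_fps (\<lambda>m. of_int (fps_nth A m)))"
  have h_mult: "h (A * B) = h A * h B" for A B
    by (simp add: h_def fps_eq_iff fps_mult_nth)
  have h_1: "h 1 = 1"
    by (simp add: h_def fps_eq_iff)
  have "\<exists>A. gf_factor (k + 1) = h A \<and> fps_X ^ (k + 1) dvd A - 1" for k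
    unfolding h_def by (rule gf_factor_int[of "k + 1"]) auto
  then obtain A where A: "\<And>k. gf_factor (k + 1) = h (A k)" "\<And>k. fps_X ^ (k + 1) dvd A k - 1"
    by metis
  define P where "P n = (\<Prod>k\<le>n. A k)" for n
  have hP: "(\<Prod>k\<le>n. gf_factor (k + 1)) = h (P n)" for n
  proof (induction n)
    case 0
    show ?case using A(1)[of 0] by (simp add: P_def)
  next
    case (Suc n)
    then show ?case using A(1)[of "Suc n"] by (simp add: P_def h_mult)
  qed
  have coeff_Suc: "fps_nth (P (Suc n)) j = fps_nth (P n) j" if "j \<le> n" for n j
  proof -
    have "fps_X ^ (n + 2) dvd A (Suc n) - 1"
      using A(2)[of "Suc n"] by simp
    then have "fps_X ^ (n + 2) dvd P n * (A (Suc n) - 1)"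
      by (rule dvd_mult)
    moreover have "P n * (A (Suc n) - 1) = P (Suc n) - P n"
      by (simp add: P_def algebra_simps)
    ultimately have "fps_X ^ (n + 2) dvd P (Suc n) - P n"
      by simp
    then obtain B where B: "P (Suc n) - P n = fps_X ^ (n + 2) * B" ..
    have "fps_nth (P (Suc n) - P n) j = 0"
      unfolding B by (subst fps_X_power_mult_nth) (use that in auto)
    then show ?thesis by simp
  qed
  have stable: "fps_nth (P n) j = fps_nth (P j) j" if "j \<le> n" for n j
    using that
  proof (induction n rule: dec_induct)
    case base
    show ?case by (rule refl)
  next
    case (step m)
    then show ?case using coeff_Suc[of j m] by simp
  qed
  define L where "L = Abs_fps (\<lambda>j. fps_nth (P j) j)"
  have lim: "(\<lambda>n. \<Prod>k\<le>n. gf_factor (k + 1)) \<longlonglongrightarrow> h L"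
    unfolding hP tendsto_fps_iff
  proof
    fix j
    show "\<forall>\<^sub>F n in sequentially. fps_nth (h (P n)) j = fps_nth (h L) j"
      using eventually_ge_at_top[of j]
    proof eventually_elim
      case (elim n)
      then show ?case using stable[of j n] by (simp add: h_def L_def)
    qed
  qed
  have "fps_X dvd A 0 - 1"
    using A(2)[of 0] by simp
  then obtain B where B: "A 0 - 1 = fps_X * B" ..
  have "fps_nth (A 0 - 1) 0 = 0"
    unfolding B by simp
  then have "fps_nth (h L) 0 = 1"
    by (simp add: h_def L_def P_def)
  then have "h L \<noteq> 0"
    by auto
  with lim have prod: "(\<lambda>k. gf_factor (k + 1)) has_prod h L"
    by (simp add: has_prod_def raw_has_prod_def)
  show ?thesis
  proof (rule ex1I)
    show "(\<lambda>k. gf_factor (k + 1)) has_prod Abs_fps (\<lambda>m. of_int (fps_nth L m))"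
      using prod by (simp add: h_def)
  next
    fix f :: "nat \<Rightarrow> int"
    assume "(\<lambda>k. gf_factor (k + 1)) has_prod Abs_fps (\<lambda>m. of_int (f m))"
    with prod have "h L = Abs_fps (\<lambda>m. of_int (f m))"
      using has_prod_unique2 by blast
    then show "f = fps_nth L"
      by (auto simp: h_def fps_eq_iff fun_eq_iff)
  qed
qed

end

theory Submission
  imports Defs
begin

text \<open>
  Modulo 2 the number of even hooks is the sum over all cells of arm length plus leg length,
  which equals \<open>\<Sum>\<^sub>i ((\<lambda>\<^sub>i choose 2) + (i - 1) \<lambda>\<^sub>i)\<close>. This statistic behaves well under removal of the largest
  part, so the signed generating functions \<open>A\<^sub>N(q)\<close> of the partitions with parts at most \<open>N\<close> satisfy
  \<open>A\<^sub>N(q) = A\<^bsub>N-1\<^esub>(q) \<plusminus> q\<^sup>N A\<^sub>N(- q)\<close>. With \<open>p = - q\<^sup>2\<close> this recursion is solved by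
  \<open>(p; p)\<^sub>N A\<^sub>N(q) = \<Sum>\<^sub>d [N, d + \<lfloor>N/2\<rfloor>]\<^sub>p q\<^bsup>2 d d - d\<^esup>\<close>, a finite form of the 2-core and 2-quotient
  decomposition (the exponents are the sizes of the 2-cores). Replacing \<open>p\<close> by \<open>q\<^sup>4\<close> in the Gaussian
  binomials turns the same sum into a finite Jacobi triple product, equal to \<open>\<Prod>\<^sub>i (1 + q\<^bsup>2 i - 1\<^esup>)\<close>
  over \<open>i \<le> N\<close>. For \<open>N = 2 M\<close> both sums, multiplied by their \<open>(P; P)\<^sub>M\<close>, agree up to
  degree \<open>M\<close>, because \<open>(P; P)\<^sub>M [2 M, k]\<^sub>P \<equiv> 1\<close> up to degree \<open>min k (2 M - k)\<close>. Comparing the two gives the product.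
\<close>

section \<open>Gaussian binomial coefficients\<close>

text \<open>Defined by a Pascal rule instead of a quotient, so that the coefficients exist in every
  commutative ring and can be taken at \<open>- x\<^sup>2\<close> as well as at
  \<open>x ^ 4\<close>.\<close>

fun qbinom :: "'a::comm_ring_1 \<Rightarrow> nat \<Rightarrow> nat \<Rightarrow> 'a" where
  "qbinom P n 0 = 1"
| "qbinom P 0 (Suc k) = 0"
| "qbinom P (Suc n) (Suc k) = qbinom P n k + P ^ Suc k * qbinom P n (Suc k)"

text \<open>The Pochhammer product (P; P)_n, without the powers of 1 - P that the usual q-factorial
  divides out.\<close>

definition qfact :: "'a::comm_ring_1 \<Rightarrow> nat \<Rightarrow> 'a" where
  "qfact P n = (\<Prod>i<n. 1 - P ^ Suc i)"

lemma qfact_Suc: "qfact P (Suc n) = qfact P n * (1 - P ^ Suc n)"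
  by (simp add: qfact_def)

lemma qbinom_eq_0: "n < k \<Longrightarrow> qbinom P n k = 0"
  by (induction P n k rule: qbinom.induct) auto

lemma qbinom_self: "qbinom P n n = 1"
  by (induction n) (auto simp: qbinom_eq_0)

text \<open>The companion Pascal rule, with the weight on the other term. Unfolding the defining
  rule, using the induction hypothesis twice and refolding works because
  \<open>P ^ (l + 2) * P ^ (n - Suc l)\<close> equals
  \<open>P ^ (n - l) * P ^ Suc l\<close>.\<close>

lemma qbinom_Suc_Suc':
  "k \<le> n \<Longrightarrow> qbinom P (Suc n) (Suc k) = P ^ (n - k) * qbinom P n k + qbinom P n (Suc k)"
proof (induction n arbitrary: k)
  case 0
  then show ?case by simp
next
  case (Suc n)
  show ?case
  proof (cases k)
    case 0
    have "qbinom P (Suc (Suc n)) (Suc 0) = 1 + P * qbinom P (Suc n) (Suc 0)"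
      by simp
    also have "\<dots> = 1 + P * (P ^ n + qbinom P n (Suc 0))"
      using Suc.IH[of 0] by simp
    finally show ?thesis using 0 by (simp add: algebra_simps)
  next
    case (Suc l)
    show ?thesis
    proof (cases "l = n")
      case True
      then show ?thesis using Suc by (simp add: qbinom_self qbinom_eq_0)
    next
      case False
      with Suc Suc.prems have l: "Suc l \<le> n" by simp
      then obtain d where d: "n = Suc l + d" by (auto simp: le_iff_add)
      have "qbinom P (Suc (Suc n)) (Suc (Suc l))
        = qbinom P (Suc n) (Suc l) + P ^ (l + 2) * qbinom P (Suc n) (Suc (Suc l))"
        by simp
      also have "\<dots> = (P ^ (n - l) * qbinom P n l + qbinom P n (Suc l))
          + P ^ (l + 2) * (P ^ (n - Suc l) * qbinom P n (Suc l) + qbinom P n (Suc (Suc l)))"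
        using Suc.IH[of l] Suc.IH[of "Suc l"] l by simp
      also have "\<dots> = P ^ (n - l) * (qbinom P n l + P ^ Suc l * qbinom P n (Suc l))
          + (qbinom P n (Suc l) + P ^ (l + 2) * qbinom P n (Suc (Suc l)))"
        by (simp add: d algebra_simps power_add)
      finally show ?thesis using Suc by simp
    qed
  qed
qed

text \<open>Replacing \<open>k\<close> by \<open>n - k\<close> interchanges the two Pascal
  rules.\<close>

lemma qbinom_symmetric: "k \<le> n \<Longrightarrow> qbinom P n (n - k) = qbinom P n k"
proof (induction n arbitrary: k)
  case 0
  then show ?case by simp
next
  case (Suc n)
  show ?case
  proof (cases k)
    case 0
    then show ?thesis by (simp add: qbinom_self del: qbinom.simps(3))
  next
    case (Suc l)
    show ?thesis
    proof (cases "l = n")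
      case True
      then show ?thesis using Suc by (simp add: qbinom_self del: qbinom.simps(3))
    next
      case False
      with Suc Suc.prems have l: "Suc l \<le> n" by simp
      then have eq: "Suc n - k = Suc (n - Suc l)" and nl: "Suc (n - Suc l) = n - l"
        and le: "n - Suc l \<le> n" using Suc by auto
      have "qbinom P (Suc n) (Suc n - k)
        = P ^ (n - (n - Suc l)) * qbinom P n (n - Suc l) + qbinom P n (Suc (n - Suc l))"
        unfolding eq by (rule qbinom_Suc_Suc'[OF le])
      also have "\<dots> = P ^ Suc l * qbinom P n (Suc l) + qbinom P n l"
        unfolding nl using Suc.IH[of l] Suc.IH[of "Suc l"] l by simp
      finally show ?thesis using Suc by simp
    qed
  qed
qed

text \<open>The quotient formula in division-free form. The induction step rests on 1 - P^(k+l) = (1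
  - P^k) + P^k (1 - P^l).\<close>

lemma qbinom_qfact: "qbinom P (k + l) k * (qfact P k * qfact P l) = qfact P (k + l)"
proof (induction "k + l" arbitrary: k l)
  case 0
  then show ?case by (simp add: qfact_def)
next
  case (Suc n)
  consider "k = 0" | "l = 0" | k' l' where "k = Suc k'" "l = Suc l'"
    by (metis not0_implies_Suc)
  then show ?case
  proof cases
    case 3
    let ?q = "qbinom P (k' + Suc l')"
    have 1: "?q k' * (qfact P k' * qfact P (Suc l')) = qfact P (k' + Suc l')"
      using Suc.hyps(1)[of k' "Suc l'"] Suc.hyps(2) 3 by simp
    have 2: "?q (Suc k') * (qfact P (Suc k') * qfact P l') = qfact P (k' + Suc l')"
      using Suc.hyps(1)[of "Suc k'" l'] Suc.hyps(2) 3 by simp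
    have "qbinom P (k + l) k * (qfact P k * qfact P l)
      = (?q k' + P ^ Suc k' * ?q (Suc k')) * (qfact P (Suc k') * qfact P (Suc l'))"
      using 3 by simp
    also have "\<dots> = (1 - P ^ Suc k') * (?q k' * (qfact P k' * qfact P (Suc l')))
        + P ^ Suc k' * (1 - P ^ Suc l') * (?q (Suc k') * (qfact P (Suc k') * qfact P l'))"
      by (simp add: qfact_Suc algebra_simps)
    also have "\<dots> = qfact P (k' + Suc l') * (1 - P ^ Suc (k' + Suc l'))"
      unfolding 1 2 by (simp add: algebra_simps power_add)
    also have "\<dots> = qfact P (k + l)"
      unfolding 3 add_Suc qfact_Suc ..
    finally show ?thesis .
  qed (simp_all add: qfact_def qbinom_self)
qed

section \<open>Sums of Gaussian binomials over 2-cores\<close>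

text \<open>For \<open>d \<in> \<int>\<close> these are the triangular numbers, each once: the sizes of the 2-cores.\<close>

definition core_size :: "int \<Rightarrow> nat" where
  "core_size d = nat (2 * d\<^sup>2 - d)"

lemma int_core_size: "int (core_size d) = 2 * d\<^sup>2 - d"
proof -
  have "\<bar>d\<bar> \<le> d\<^sup>2"
    using self_le_power[of "\<bar>d\<bar>" 2] by (cases "d = 0") auto
  then have "d \<le> 2 * d\<^sup>2" by linarith
  then show ?thesis by (simp add: core_size_def)
qed

lemma abs_le_core_size: "\<bar>d\<bar> \<le> int (core_size d)"
proof -
  have "\<bar>d\<bar> \<le> d\<^sup>2"
    using self_le_power[of "\<bar>d\<bar>" 2] by (cases "d = 0") auto
  then show ?thesis unfolding int_core_size by linarith
qed

lemma even_core_size: "even (core_size d) \<longleftrightarrow> even d"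
proof -
  have "even (int (core_size d)) \<longleftrightarrow> even d"
    unfolding int_core_size by simp
  then show ?thesis by simp
qed

text \<open>\<open>P\<close> and \<open>x\<close> are independent because the same sum is needed for
  two bases: \<open>- x\<^sup>2\<close> for the partitions and \<open>x ^ 4\<close> for the
  product.\<close>

definition core_poly :: "'a::comm_ring_1 \<Rightarrow> 'a \<Rightarrow> nat \<Rightarrow> 'a" where
  "core_poly P x n = (\<Sum>k\<le>n. qbinom P n k * x ^ core_size (int k - int (n div 2)))"

lemma core_poly_0: "core_poly P x 0 = 1"
  by (simp add: core_poly_def core_size_def)

text \<open>Here \<open>Suc n div 2 = n div 2\<close>, so the offset stays put and the Pascal rule
  that leaves \<open>qbinom P n (Suc k)\<close> unweighted splits off the old sum.\<close>

lemma core_poly_Suc_even: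
  assumes "even n"
  shows "core_poly P x (Suc n) = core_poly P x n +
    (\<Sum>k\<le>n. P ^ (n - k) * qbinom P n k * x ^ core_size (int k + 1 - int (n div 2)))"
proof -
  let ?x = "\<lambda>k. x ^ core_size (int k - int (n div 2))"
  have "core_poly P x (Suc n) = ?x 0 + (\<Sum>k\<le>n. qbinom P (Suc n) (Suc k) * ?x (Suc k))"
    using assms by (simp add: core_poly_def sum.atMost_Suc_shift del: qbinom.simps(3) sum.atMost_Suc)
  also have "(\<Sum>k\<le>n. qbinom P (Suc n) (Suc k) * ?x (Suc k))
    = (\<Sum>k\<le>n. qbinom P n (Suc k) * ?x (Suc k)) + (\<Sum>k\<le>n. P ^ (n - k) * qbinom P n k * ?x (Suc k))"
    unfolding sum.distrib[symmetric]
    by (intro sum.cong refl) (simp add: qbinom_Suc_Suc' algebra_simps del: qbinom.simps(3))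
  \<comment> \<open>The lone term is the summand for \<open>k = 0\<close>; the new top summand at
    \<open>Suc n\<close> is zero.\<close>
  also have "?x 0 + \<dots> = (\<Sum>k\<le>Suc n. qbinom P n k * ?x k) +
      (\<Sum>k\<le>n. P ^ (n - k) * qbinom P n k * ?x (Suc k))"
    by (simp add: sum.atMost_Suc_shift del: sum.atMost_Suc)
  finally show ?thesis
    by (simp add: core_poly_def qbinom_eq_0 algebra_simps)
qed

text \<open>Now the offset grows by one, so the old sum reappears shifted by one index; this calls
  for the Pascal rule that leaves \<open>qbinom P n k\<close> unweighted.\<close>

lemma core_poly_Suc_odd:
  assumes "odd n"
  shows "core_poly P x (Suc n) = core_poly P x n +
    (\<Sum>k\<le>n. P ^ k * qbinom P n k * x ^ core_size (int k - 1 - int (n div 2)))"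
proof -
  let ?x = "\<lambda>k. x ^ core_size (int k - 1 - int (n div 2))"
  have div: "Suc n div 2 = Suc (n div 2)"
    using assms by simp
  have "core_poly P x (Suc n) = ?x 0 + (\<Sum>k\<le>n. qbinom P (Suc n) (Suc k) * ?x (Suc k))"
    unfolding core_poly_def div
    by (simp add: sum.atMost_Suc_shift algebra_simps del: qbinom.simps(3) sum.atMost_Suc)
  also have "(\<Sum>k\<le>n. qbinom P (Suc n) (Suc k) * ?x (Suc k))
    = (\<Sum>k\<le>n. qbinom P n k * ?x (Suc k)) + (\<Sum>k\<le>n. P ^ Suc k * qbinom P n (Suc k) * ?x (Suc k))"
    unfolding sum.distrib[symmetric]
    by (intro sum.cong refl) (simp add: algebra_simps)
  also have "?x 0 + \<dots> = (\<Sum>k\<le>n. qbinom P n k * ?x (Suc k)) +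
      (\<Sum>k\<le>Suc n. P ^ k * qbinom P n k * ?x k)"
    by (simp add: sum.atMost_Suc_shift del: sum.atMost_Suc)
  finally show ?thesis
    by (simp add: core_poly_def qbinom_eq_0)
qed

text \<open>For base \<open>x ^ 4\<close> the weight exactly compensates the change of core size:
  every summand of the correction is \<open>x ^ (2 * n + 1)\<close> times the corresponding summand
  of the old sum.\<close>

lemma core_poly_triple_product:
  "core_poly (x ^ 4) x n = (\<Prod>i<n. 1 + x ^ (2 * i + 1))"
proof (induction n)
  case 0
  show ?case by (simp add: core_poly_0)
next
  case (Suc n)
  define m where "m = n div 2"
  have "core_poly (x ^ 4) x (Suc n) = core_poly (x ^ 4) x n + x ^ (2 * n + 1) * core_poly (x ^ 4) x n"
  proof (cases "even n")
    case True
    then have n: "int n = 2 * int m" by (auto simp: m_def)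
    have "(x ^ 4) ^ (n - k) * qbinom (x ^ 4) n k * x ^ core_size (int k + 1 - int m)
      = x ^ (2 * n + 1) * (qbinom (x ^ 4) n k * x ^ core_size (int k - int m))" if "k \<le> n" for k
    proof -
      have "int (4 * (n - k) + core_size (int k + 1 - int m)) = int (2 * n + 1 + core_size (int k - int m))"
        using that n by (simp add: int_core_size of_nat_diff power2_eq_square algebra_simps)
      then have "x ^ (4 * (n - k) + core_size (int k + 1 - int m)) = x ^ (2 * n + 1 + core_size (int k - int m))"
        by (simp only: of_nat_eq_iff)
      from arg_cong[OF this, of "\<lambda>z. qbinom (x ^ 4) n k * z"] show ?thesis
        unfolding power_mult[symmetric] by (simp only: power_add mult_ac)
    qed
    then show ?thesis
      unfolding core_poly_Suc_even[OF True] by (simp add: core_poly_def m_def sum_distrib_left)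
  next
    case False
    then have n: "int n = 2 * int m + 1" by (auto simp: m_def elim!: oddE)
    have "(x ^ 4) ^ k * qbinom (x ^ 4) n k * x ^ core_size (int k - 1 - int m)
      = x ^ (2 * n + 1) * (qbinom (x ^ 4) n k * x ^ core_size (int k - int m))" for k
    proof -
      have "int (4 * k + core_size (int k - 1 - int m)) = int (2 * n + 1 + core_size (int k - int m))"
        using n by (simp add: int_core_size power2_eq_square algebra_simps)
      then have "x ^ (4 * k + core_size (int k - 1 - int m)) = x ^ (2 * n + 1 + core_size (int k - int m))"
        by (simp only: of_nat_eq_iff)
      from arg_cong[OF this, of "\<lambda>z. qbinom (x ^ 4) n k * z"] show ?thesis
        unfolding power_mult[symmetric] by (simp only: power_add mult_ac)
    qed
    then show ?thesis
      unfolding core_poly_Suc_odd[OF False] by (simp add: core_poly_def m_def sum_distrib_left)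
  qed
  then show ?case using Suc.IH by (simp add: algebra_simps)
qed

text \<open>For base \<open>- x\<^sup>2\<close> the exponents match only after the reflection of
  \<open>k\<close> to \<open>n - k\<close>. The remaining sign depends on the parity of the core
  index, which is that of the core size, and is absorbed by passing to \<open>- x\<close>.\<close>

lemma core_poly_Suc:
  "core_poly (- x\<^sup>2) x (Suc n) = core_poly (- x\<^sup>2) x n +
     (- 1) ^ (Suc n div 2) * x ^ Suc n * core_poly (- x\<^sup>2) (- x) n"
proof -
  define P where "P = - x\<^sup>2"
  define m where "m = n div 2"
  have P: "P ^ k = (- 1) ^ k * x ^ (2 * k)" for k
    unfolding P_def by (subst power_minus) (simp add: power_mult)
  \<comment> \<open>Reduces each comparison of signed monomials below to a parity and an equation
    between exponents.\<close>
  have sgn: "(-1) ^ a * x ^ b = (-1) ^ c * (-x) ^ d * x ^ e"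
    if "even (a + c + d)" "int b = int d + int e" for a b c d e
  proof -
    have "b = d + e" using that(2) by linarith
    moreover have "(-1 :: 'a) ^ a = (-1) ^ (c + d)"
      using that(1) by (cases "even a") auto
    ultimately show ?thesis
      by (subst power_minus[of x d]) (simp add: power_add mult_ac)
  qed
  have "core_poly P x (Suc n) = core_poly P x n +
     (- 1) ^ (Suc n div 2) * x ^ Suc n * core_poly P (- x) n"
  proof (cases "even n")
    case True
    then have n: "int n = 2 * int m" by (auto simp: m_def)
    have d: "Suc n div 2 = m" using True by (simp add: m_def)
    have "(\<Sum>k\<le>n. P ^ (n - k) * qbinom P n k * x ^ core_size (int k + 1 - int m))
      = (\<Sum>k\<le>n. P ^ k * qbinom P n k * x ^ core_size (int (n - k) + 1 - int m))"
      by (rule sum.reindex_bij_witness[of _ "\<lambda>k. n - k" "\<lambda>k. n - k"]) (auto simp: qbinom_symmetric)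
    also have "\<dots> = (\<Sum>k\<le>n. (- 1) ^ m * x ^ Suc n * (qbinom P n k * (- x) ^ core_size (int k - int m)))"
    proof (rule sum.cong[OF refl])
      fix k assume "k \<in> {..n}"
      then have k: "k \<le> n" by simp
      have "even (k + m + core_size (int k - int m))"
        by (simp add: even_core_size)
      moreover have "int (2 * k + core_size (int (n - k) + 1 - int m))
        = int (core_size (int k - int m)) + int (Suc n)"
        using n k by (simp add: int_core_size of_nat_diff power2_eq_square algebra_simps)
      ultimately have "(-1) ^ k * x ^ (2 * k + core_size (int (n - k) + 1 - int m))
        = (-1) ^ m * (-x) ^ core_size (int k - int m) * x ^ Suc n"
        by (rule sgn)
      from arg_cong[OF this, of "\<lambda>z. qbinom P n k * z"]
      show "P ^ k * qbinom P n k * x ^ core_size (int (n - k) + 1 - int m)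
        = (- 1) ^ m * x ^ Suc n * (qbinom P n k * (- x) ^ core_size (int k - int m))"
        unfolding P by (simp only: power_add mult_ac)
    qed
    finally show ?thesis
      unfolding core_poly_Suc_even[OF True] d by (simp add: core_poly_def m_def sum_distrib_left)
  next
    case False
    then have n: "int n = 2 * int m + 1" by (auto simp: m_def elim!: oddE)
    have d: "Suc n div 2 = Suc m" using False by (simp add: m_def)
    have "(\<Sum>k\<le>n. P ^ k * qbinom P n k * x ^ core_size (int k - 1 - int m))
      = (\<Sum>k\<le>n. P ^ (n - k) * qbinom P n k * x ^ core_size (int (n - k) - 1 - int m))"
      by (rule sum.reindex_bij_witness[of _ "\<lambda>k. n - k" "\<lambda>k. n - k"]) (auto simp: qbinom_symmetric)
    also have "\<dots> = (\<Sum>k\<le>n. (- 1) ^ Suc m * x ^ Suc n * (qbinom P n k * (- x) ^ core_size (int k - int m)))"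
    proof (rule sum.cong[OF refl])
      fix k assume "k \<in> {..n}"
      then have k: "k \<le> n" by simp
      have "even (n - k + Suc m + core_size (int k - int m))"
        using False k by (auto simp: even_core_size)
      moreover have "int (2 * (n - k) + core_size (int (n - k) - 1 - int m))
        = int (core_size (int k - int m)) + int (Suc n)"
        using n k by (simp add: int_core_size of_nat_diff power2_eq_square algebra_simps)
      ultimately have "(-1) ^ (n - k) * x ^ (2 * (n - k) + core_size (int (n - k) - 1 - int m))
        = (-1) ^ Suc m * (-x) ^ core_size (int k - int m) * x ^ Suc n"
        by (rule sgn)
      from arg_cong[OF this, of "\<lambda>z. qbinom P n k * z"]
      show "P ^ (n - k) * qbinom P n k * x ^ core_size (int (n - k) - 1 - int m)
        = (- 1) ^ Suc m * x ^ Suc n * (qbinom P n k * (- x) ^ core_size (int k - int m))"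
        unfolding P by (simp only: power_add mult_ac)
    qed
    finally show ?thesis
      unfolding core_poly_Suc_odd[OF False] d by (simp add: core_poly_def m_def sum_distrib_left)
  qed
  then show ?thesis by (simp add: P_def)
qed

section \<open>Congruence of power series up to a degree\<close>

definition fps_cong :: "nat \<Rightarrow> 'a::comm_ring_1 fps \<Rightarrow> 'a fps \<Rightarrow> bool" where
  "fps_cong L A B \<longleftrightarrow> (\<forall>n\<le>L. fps_nth A n = fps_nth B n)"

lemma fps_cong_refl: "fps_cong L A A"
  and fps_cong_sym: "fps_cong L A B \<Longrightarrow> fps_cong L B A"
  and fps_cong_trans [trans]: "fps_cong L A B \<Longrightarrow> fps_cong L B C \<Longrightarrow> fps_cong L A C"
  by (auto simp: fps_cong_def)

lemma fps_cong_mult: "fps_cong L A B \<Longrightarrow> fps_cong L C D \<Longrightarrow> fps_cong L (A * C) (B * D)"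
  by (auto simp: fps_cong_def fps_mult_nth intro!: sum.cong)

lemma fps_cong_cancel:
  fixes U :: "'a::field fps"
  assumes "fps_cong L (U * A) (U * B)" "fps_nth U 0 \<noteq> 0"
  shows "fps_cong L A B"
proof -
  have "fps_cong L (inverse U * (U * A)) (inverse U * (U * B))"
    by (intro fps_cong_mult fps_cong_refl assms(1))
  then show ?thesis
    using assms(2) by (simp add: inverse_mult_eq_1 flip: mult.assoc)
qed

lemma fps_cong_prod_lessThan:
  assumes "K \<le> N" and "\<And>i. K \<le> i \<Longrightarrow> i < N \<Longrightarrow> fps_cong L (F i) 1"
  shows "fps_cong L (\<Prod>i<N. F i) (\<Prod>i<K::nat. F i)"
  using assms
proof (induction N rule: dec_induct)
  case base
  show ?case by (rule fps_cong_refl)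
next
  case (step n)
  then have "fps_cong L ((\<Prod>i<n. F i) * F n) ((\<Prod>i<K. F i) * 1)"
    by (intro fps_cong_mult) auto
  then show ?case by simp
qed

lemma fps_nth_power_eq_0:
  fixes P :: "'a::comm_ring_1 fps"
  assumes "fps_nth P 0 = 0" "j < i"
  shows "fps_nth (P ^ i) j = 0"
  using startsby_zero_power_prefix[OF assms(1)] assms(2) by blast

text \<open>Without a constant term in \<open>P\<close>, each factor \<open>1 - P ^ Suc i\<close>
  with \<open>L \<le> i\<close> is 1 up to degree \<open>L\<close>; both products therefore reduce
  to \<open>qfact P L\<close>.\<close>

lemma fps_cong_qfact:
  fixes P :: "'a::comm_ring_1 fps"
  assumes "fps_nth P 0 = 0" "L \<le> K" "L \<le> N"
  shows "fps_cong L (qfact P N) (qfact P K)"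
proof -
  have "fps_cong L (qfact P M) (qfact P L)" if "L \<le> M" for M :: nat
    unfolding qfact_def using that
  proof (rule fps_cong_prod_lessThan)
    fix i assume "L \<le> i"
    then show "fps_cong L (1 - P ^ Suc i) 1"
      using fps_nth_power_eq_0[OF assms(1)] by (auto simp: fps_cong_def simp del: power_Suc)
  qed
  from this[OF assms(2)] this[OF assms(3)] show ?thesis
    by (metis fps_cong_sym fps_cong_trans)
qed

lemma fps_nth_qfact_0:
  fixes P :: "'a::comm_ring_1 fps"
  assumes "fps_nth P 0 = 0"
  shows "fps_nth (qfact P N) 0 = 1"
proof -
  have "fps_cong 0 (qfact P N) (qfact P 0)"
    by (rule fps_cong_qfact[OF assms]) auto
  then show ?thesis by (simp add: fps_cong_def qfact_def)
qed

text \<open>In \<open>qbinom_qfact\<close> all three products are congruent to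
  \<open>qfact P M\<close>, which is a unit and can be cancelled once.\<close>

lemma fps_cong_qbinom_qfact:
  fixes P :: "'a::field fps"
  assumes P: "fps_nth P 0 = 0" and L: "L \<le> k" "L \<le> l" "L \<le> M"
  shows "fps_cong L (qfact P M * qbinom P (k + l) k) 1"
proof -
  let ?Q = "qfact P M"
  have cong: "fps_cong L ?Q (qfact P N)" if "L \<le> N" for N
    using fps_cong_qfact[OF P] that L by auto
  have "fps_cong L (qbinom P (k + l) k * (?Q * ?Q)) (qbinom P (k + l) k * (qfact P k * qfact P l))"
    using L by (intro fps_cong_mult fps_cong_refl cong)
  also have "qbinom P (k + l) k * (qfact P k * qfact P l) = qfact P (k + l)"
    by (rule qbinom_qfact)
  also have "fps_cong L \<dots> ?Q"
    using L by (intro fps_cong_sym[OF cong]) simp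
  finally have "fps_cong L (?Q * (?Q * qbinom P (k + l) k)) (?Q * 1)"
    by (simp add: mult_ac)
  then show ?thesis
    by (rule fps_cong_cancel) (simp add: fps_nth_qfact_0[OF P])
qed

text \<open>The right-hand side does not mention \<open>P\<close>, which is what allows one base to
  be exchanged for the other.\<close>

lemma fps_cong_core_poly:
  fixes P :: "'a::field fps"
  assumes P: "fps_nth P 0 = 0"
  shows "fps_cong M (qfact P M * core_poly P fps_X (2 * M))
           (\<Sum>k\<le>2 * M. fps_X ^ core_size (int k - int M))"
proof -
  have "fps_nth (qfact P M * qbinom P (2 * M) k * fps_X ^ c) n = fps_nth (fps_X ^ c) n"
    if k: "k \<le> 2 * M" and n: "n \<le> M" and c: "c = core_size (int k - int M)" for k c n
  proof (cases "n < c")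
    case True
    then show ?thesis by (simp add: fps_X_power_mult_right_nth)
  next
    case False
    \<comment> \<open>The factor \<open>fps_X ^ c\<close> leaves only degrees up to
      \<open>n - c\<close> to control. Since \<open>k\<close> is within \<open>c\<close> of
      \<open>M\<close> and \<open>n \<le> M\<close>, this is at most both \<open>k\<close> and
      \<open>2 * M - k\<close>.\<close>
    have "\<bar>int k - int M\<bar> \<le> int c"
      unfolding c by (rule abs_le_core_size)
    then have "fps_cong (n - c) (qfact P M * qbinom P (k + (2 * M - k)) k) 1"
      using False n k by (intro fps_cong_qbinom_qfact P) linarith+
    then show ?thesis
      using False k by (auto simp: fps_cong_def fps_X_power_mult_right_nth)
  qed
  then show ?thesis
    by (auto simp: fps_cong_def core_poly_def sum_distrib_left fps_sum_nth mult.assoc intro!: sum.cong)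
qed

section \<open>Parity of the number of even hooks\<close>

primrec hook_stat :: "nat list \<Rightarrow> nat" where
  "hook_stat [] = 0"
| "hook_stat (x # xs) = (x choose 2) + sum_list xs + hook_stat xs"

lemma sum_lessThan_choose_two: "(\<Sum>j<x. j) = x choose 2"
  by (induction x) (auto simp: numeral_2_eq_2)

text \<open>With indices from 0, a new first row moves every other cell down by one and so adds one
  per cell, which is the \<open>sum_list\<close> term of the recursion.\<close>

lemma hook_stat_eq_sum: "hook_stat xs = (\<Sum>i<length xs. \<Sum>j<xs ! i. i + j)"
proof (induction xs)
  case Nil
  show ?case by simp
next
  case (Cons x xs)
  have Suc_inner: "(\<Sum>j<c. 1 + (i + j)) = c + (\<Sum>j<c. i + j)" for c i :: nat
    by (subst sum.distrib) simp
  have "(\<Sum>i<length (x # xs). \<Sum>j<(x # xs) ! i. i + j)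
    = (\<Sum>j<x. j) + (\<Sum>i<length xs. \<Sum>j<xs ! i. 1 + (i + j))"
    by (simp add: sum.lessThan_Suc_shift del: sum.lessThan_Suc)
  also have "\<dots> = (x choose 2) + (sum_list xs + hook_stat xs)"
    unfolding Suc_inner sum.distrib[of "(!) xs"] Cons.IH sum_lessThan_choose_two
    by (simp add: sum_list_sum_nth lessThan_atLeast0)
  finally show ?case by simp
qed

lemma young_diagram_Sigma:
  "young_diagram xs = (SIGMA i:{1..length xs}. {1..part xs i})"
  by (auto simp: young_diagram_def)

lemma finite_young_diagram: "finite (young_diagram xs)"
  by (simp add: young_diagram_Sigma)

lemma hook_stat_eq_sum_young_diagram:
  "int (hook_stat xs) = (\<Sum>(i, j)\<in>young_diagram xs. (int i - 1) + (int j - 1))"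
proof -
  have "(\<Sum>(i, j)\<in>young_diagram xs. (int i - 1) + (int j - 1))
    = (\<Sum>i\<in>{1..length xs}. \<Sum>j\<in>{1..part xs i}. (int i - 1) + (int j - 1))"
    unfolding young_diagram_Sigma by (subst sum.Sigma) auto
  also have "\<dots> = (\<Sum>i<length xs. \<Sum>j\<in>{1..part xs (Suc i)}. int i + (int j - 1))"
    by (rule sum.reindex_bij_witness[of _ Suc "\<lambda>i. i - 1"]) auto
  also have "\<dots> = (\<Sum>i<length xs. \<Sum>j<xs ! i. int i + int j)"
  proof (rule sum.cong[OF refl])
    fix i assume "i \<in> {..<length xs}"
    then show "(\<Sum>j\<in>{1..part xs (Suc i)}. int i + (int j - 1)) = (\<Sum>j<xs ! i. int i + int j)"
      by (intro sum.reindex_bij_witness[of _ Suc "\<lambda>j. j - 1"]) (auto simp: part_def)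
  qed
  finally show ?thesis by (simp add: hook_stat_eq_sum)
qed

lemma part_antimono:
  assumes "sorted_wrt (\<ge>) xs" "1 \<le> i" "i \<le> k"
  shows "part xs k \<le> part xs i"
proof (cases "i = k")
  case False
  then show ?thesis
    using assms sorted_wrt_nth_less[OF assms(1), of "i - 1" "k - 1"] by (auto simp: part_def)
qed simp

lemma down_closed_eq_atLeastAtMost_card:
  fixes S :: "nat set"
  assumes "finite S" and pos: "\<And>i. i \<in> S \<Longrightarrow> 1 \<le> i"
    and down: "\<And>i k. k \<in> S \<Longrightarrow> 1 \<le> i \<Longrightarrow> i \<le> k \<Longrightarrow> i \<in> S"
  shows "S = {1..card S}"
proof (cases "S = {}")
  case False
  have "S = {1..Max S}"
  proof (intro set_eqI iffI)
    show "i \<in> {1..Max S}" if "i \<in> S" for i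
      unfolding atLeastAtMost_iff using pos[OF that] Max_ge[OF assms(1) that] by blast
    show "i \<in> S" if "i \<in> {1..Max S}" for i
      using that down[OF Max_in[OF assms(1) False]] unfolding atLeastAtMost_iff by blast
  qed
  then have "card S = Max S"
    by (metis card_atLeastAtMost diff_Suc_1)
  with \<open>S = {1..Max S}\<close> show ?thesis by simp
qed simp

text \<open>As the parts decrease, the rows counted by \<open>conj_part\<close> form an initial
  segment. This describes the diagram by columns, as the reversal of columns requires.\<close>

lemma mem_young_diagram_conj:
  assumes "sorted_wrt (\<ge>) xs"
  shows "(i, j) \<in> young_diagram xs \<longleftrightarrow> 1 \<le> j \<and> 1 \<le> i \<and> i \<le> conj_part xs j"
proof -
  let ?S = "{i. 1 \<le> i \<and> i \<le> length xs \<and> j \<le> part xs i}"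
  have "?S = {1..card ?S}"
  proof (rule down_closed_eq_atLeastAtMost_card)
    show "finite ?S"
      by (rule finite_subset[of _ "{..length xs}"]) auto
    show "i \<in> ?S" if "k \<in> ?S" "1 \<le> i" "i \<le> k" for i k
      using that part_antimono[OF assms that(2,3)] by simp
  qed simp
  then have "i \<in> ?S \<longleftrightarrow> i \<in> {1..card ?S}"
    by (rule arg_cong)
  then show ?thesis
    by (auto simp: young_diagram_def conj_part_def)
qed

text \<open>
  A hook is even iff its arm and leg lengths have odd sum. Reversing every row turns the arm length
  of a cell into its column index minus one, and reversing every column does the same for legs.
\<close>

lemma even_num_even_hooks_iff:
  assumes "sorted_wrt (\<ge>) xs"
  shows "even (num_even_hooks xs) \<longleftrightarrow> even (hook_stat xs)"
proof -
  let ?Y = "young_diagram xs"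
  have arms: "(\<Sum>(i, j)\<in>?Y. int (part xs i) - int j) = (\<Sum>(i, j)\<in>?Y. int j - 1)"
    by (rule sum.reindex_bij_witness[of _ "\<lambda>(i, j). (i, part xs i + 1 - j)" "\<lambda>(i, j). (i, part xs i + 1 - j)"])
      (auto simp: young_diagram_def of_nat_diff)
  have legs: "(\<Sum>(i, j)\<in>?Y. int (conj_part xs j) - int i) = (\<Sum>(i, j)\<in>?Y. int i - 1)"
    by (rule sum.reindex_bij_witness[of _ "\<lambda>(i, j). (conj_part xs j + 1 - i, j)" "\<lambda>(i, j). (conj_part xs j + 1 - i, j)"])
      (auto simp: mem_young_diagram_conj[OF assms] of_nat_diff)
  have "{c \<in> ?Y. even (hook_length xs c)} = {c \<in> ?Y. odd (hook_length xs c - 1)}"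
    by auto
  \<comment> \<open>A finite sum of integers is even iff the number of its odd terms is
    even.\<close>
  then have "even (num_even_hooks xs) \<longleftrightarrow> even (\<Sum>c\<in>?Y. hook_length xs c - 1)"
    by (simp add: num_even_hooks_def even_sum_iff[OF finite_young_diagram])
  also have "(\<Sum>c\<in>?Y. hook_length xs c - 1)
    = (\<Sum>(i, j)\<in>?Y. int (part xs i) - int j) + (\<Sum>(i, j)\<in>?Y. int (conj_part xs j) - int i)"
    unfolding sum.distrib[symmetric] by (intro sum.cong) (auto simp: hook_length_def)
  also have "\<dots> = int (hook_stat xs)"
    unfolding arms legs hook_stat_eq_sum_young_diagram sum.distrib[symmetric] by (intro sum.cong) auto
  finally show ?thesis by simp
qed

section \<open>Signed generating functions for bounded parts\<close>

definition bounded_partitions :: "nat \<Rightarrow> nat \<Rightarrow> nat list set" where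
  "bounded_partitions N n = {xs. partition_of xs n \<and> (\<forall>x\<in>set xs. x \<le> N)}"

lemma length_le_sum_list: "\<forall>x\<in>set xs. 0 < x \<Longrightarrow> length xs \<le> sum_list xs" for xs :: "nat list"
  by (induction xs) auto

lemma finite_partitions: "finite {xs. partition_of xs n}"
proof (rule finite_subset)
  show "{xs. partition_of xs n} \<subseteq> {xs. set xs \<subseteq> {..n} \<and> length xs \<le> n}"
    by (auto simp: partition_of_def length_le_sum_list member_le_sum_list)
  show "finite {xs. set xs \<subseteq> {..n} \<and> length xs \<le> n}"
    by (rule finite_lists_length_le) simp
qed

lemma finite_bounded_partitions: "finite (bounded_partitions N n)"
  unfolding bounded_partitions_def by (rule finite_subset[OF _ finite_partitions]) auto

lemma bounded_partitions_0: "bounded_partitions 0 n = (if n = 0 then {[]} else {})"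
proof -
  have "xs \<in> bounded_partitions 0 n \<longleftrightarrow> xs = [] \<and> n = 0" for xs
    by (cases xs) (auto simp: bounded_partitions_def partition_of_def)
  then show ?thesis by auto
qed

lemma bounded_partitions_eq:
  "n \<le> N \<Longrightarrow> bounded_partitions N n = {xs. partition_of xs n}"
  using member_le_sum_list by (fastforce simp: bounded_partitions_def partition_of_def)

text \<open>Split by whether the part \<open>Suc N\<close> occurs; as the largest it then comes
  first, and the tail may contain it again. The condition \<open>Suc N \<le> n\<close> guards the
  truncated subtraction.\<close>

lemma bounded_partitions_Suc:
  "bounded_partitions (Suc N) n = bounded_partitions N n \<union>
     (if Suc N \<le> n then (#) (Suc N) ` bounded_partitions (Suc N) (n - Suc N) else {})"
  (is "?L = ?R")
proof (rule set_eqI)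
  fix xs
  show "xs \<in> ?L \<longleftrightarrow> xs \<in> ?R"
  proof (cases xs)
    case Nil
    then show ?thesis by (auto simp: bounded_partitions_def)
  next
    case (Cons x ys)
    show ?thesis
    proof (cases "x = Suc N")
      case True
      then show ?thesis
        using Cons by (auto simp: bounded_partitions_def partition_of_def image_iff)
    next
      case False
      then have "xs \<in> ?R \<longleftrightarrow> xs \<in> bounded_partitions N n"
        using Cons by auto
      also have "\<dots> \<longleftrightarrow> xs \<in> ?L"
        using Cons False by (fastforce simp: bounded_partitions_def partition_of_def)
      finally show ?thesis by simp
    qed
  qed
qed

text \<open>The factor \<open>s ^ n\<close> encodes the substitution of s q for q, so that s = 1 and
  s = -1 give A_N(q) and A_N(- q).\<close>

definition signed_gf :: "rat \<Rightarrow> nat \<Rightarrow> rat fps" where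
  "signed_gf s N = Abs_fps (\<lambda>n. s ^ n * (\<Sum>xs\<in>bounded_partitions N n. (- 1) ^ hook_stat xs))"

lemma signed_gf_0: "signed_gf s 0 = 1"
  by (simp add: signed_gf_def fps_eq_iff bounded_partitions_0)

text \<open>Deleting a first part k from a partition of n lowers \<open>hook_stat\<close> by (k
  choose 2) + (n - k). The sign (-1)^(n-k) turns \<open>s\<close> into \<open>- s\<close> in the
  series for the tail.\<close>

lemma signed_gf_Suc:
  "signed_gf s (Suc N) = signed_gf s N +
     (- 1) ^ (Suc N choose 2) * (fps_const s * fps_X) ^ Suc N * signed_gf (- s) (Suc N)"
proof (rule fps_ext)
  fix n
  define c where "c = Suc N choose 2"
  define k where "k = Suc N"
  let ?S = "\<lambda>N n. \<Sum>xs\<in>bounded_partitions N n. (- 1 :: rat) ^ hook_stat xs"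
  have rhs: "fps_nth ((- 1) ^ c * (fps_const s * fps_X) ^ k * B) n
    = (if n < k then 0 else (- 1) ^ c * s ^ k * fps_nth B (n - k))" for B
  proof -
    have "(- 1 :: rat fps) ^ c = fps_const ((- 1) ^ c)"
      by (cases "even c") (auto simp flip: fps_const_neg)
    then have "(- 1) ^ c * (fps_const s * fps_X) ^ k * B = fps_const ((- 1) ^ c * s ^ k) * (fps_X ^ k * B)"
      by (simp only: power_mult_distrib fps_const_power mult.assoc flip: fps_const_mult)
    then show ?thesis
      by (simp only: fps_mult_left_const_nth fps_X_power_mult_nth) simp
  qed
  have "?S k n = ?S N n + (if n < k then 0 else (- 1) ^ c * (- 1) ^ (n - k) * ?S k (n - k))"
  proof (cases "n < k")
    case True
    then show ?thesis using bounded_partitions_Suc[of N n] by (simp add: k_def)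
  next
    case False
    then have "?S k n = ?S N n + (\<Sum>xs\<in>(#) k ` bounded_partitions k (n - k). (- 1) ^ hook_stat xs)"
      unfolding k_def bounded_partitions_Suc[of N n]
      by (subst if_P, simp, intro sum.union_disjoint)
        (auto simp: finite_bounded_partitions, auto simp: bounded_partitions_def)
    also have "(\<Sum>xs\<in>(#) k ` bounded_partitions k (n - k). (- 1) ^ hook_stat xs)
      = (\<Sum>xs\<in>bounded_partitions k (n - k). (- 1) ^ c * (- 1) ^ (n - k) * (- 1 :: rat) ^ hook_stat xs)"
      by (subst sum.reindex) (auto simp: power_add c_def k_def bounded_partitions_def partition_of_def
          intro!: sum.cong)
    finally show ?thesis using False by (simp add: sum_distrib_left)
  qed
  then have "fps_nth (signed_gf s k) n = s ^ n * ?S N n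
    + (if n < k then 0 else (- 1) ^ c * (s ^ n * (- 1) ^ (n - k)) * ?S k (n - k))"
    by (simp add: signed_gf_def distrib_left mult.assoc mult.left_commute[of "s ^ n"])
  moreover have "s ^ n * (- 1) ^ (n - k) = s ^ k * (- s) ^ (n - k)" if "\<not> n < k"
    using that power_add[of s k "n - k"] by (subst power_minus[of s]) simp
  ultimately have "fps_nth (signed_gf s k) n = fps_nth (signed_gf s N) n
    + (if n < k then 0 else (- 1) ^ c * s ^ k * fps_nth (signed_gf (- s) k) (n - k))"
    by (simp add: signed_gf_def mult.assoc)
  then show "fps_nth (signed_gf s (Suc N)) n = fps_nth (signed_gf s N +
     (- 1) ^ (Suc N choose 2) * (fps_const s * fps_X) ^ Suc N * signed_gf (- s) (Suc N)) n"
    unfolding fps_add_nth rhs[unfolded c_def k_def] by (simp only: c_def k_def)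
qed

text \<open>Matches the sign produced by \<open>hook_stat\<close> with the one in
  \<open>core_poly_Suc\<close>.\<close>

lemma even_choose_two: "even (n choose 2) \<longleftrightarrow> even (n div 2)"
proof (induction n rule: induct_nat_012)
  case (ge2 n)
  have "Suc (Suc n) choose 2 = 2 * n + 1 + (n choose 2)"
    by (simp add: numeral_2_eq_2)
  then show ?case using ge2(1) by simp
qed (auto simp: numeral_2_eq_2)

text \<open>\<open>signed_gf_Suc\<close> for \<open>s\<close> and for \<open>- s\<close> is a linear
  system in the two series at \<open>Suc N\<close>. Eliminating one of them leaves the factor
  \<open>1 - w * w'\<close>, which is the new factor of \<open>qfact\<close>, and the result is the
  recursion of \<open>core_poly_Suc\<close>. The induction keeps \<open>s\<close> arbitrary since
  both signs are needed.\<close>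

lemma qfact_mult_signed_gf:
  assumes "s\<^sup>2 = 1"
  shows "qfact (- fps_X\<^sup>2) N * signed_gf s N = core_poly (- fps_X\<^sup>2) (fps_const s * fps_X) N"
  using assms
proof (induction N arbitrary: s)
  case 0
  show ?case by (simp add: qfact_def signed_gf_0 core_poly_0)
next
  case (Suc N)
  define P :: "rat fps" where "P = - fps_X\<^sup>2"
  define x where "x = fps_const s * fps_X"
  define w where "w = (- 1) ^ (Suc N choose 2) * x ^ Suc N"
  define w' where "w' = (- 1) ^ (Suc N choose 2) * (- x) ^ Suc N"
  have x2: "- x\<^sup>2 = P"
    using Suc.prems by (simp only: x_def P_def power_mult_distrib fps_const_power) simp
  have xm: "fps_const (- s) * fps_X = - x"
    by (simp add: x_def flip: fps_const_neg)
  have w: "w = (- 1) ^ (Suc N div 2) * x ^ Suc N"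
    using even_choose_two[of "Suc N"] by (cases "even (Suc N choose 2)") (auto simp: w_def)
  have "w * w' = ((- 1) ^ (Suc N choose 2)) ^ 2 * (x * - x) ^ Suc N"
    unfolding w_def w'_def power2_eq_square power_mult_distrib by (simp only: mult_ac)
  also have "\<dots> = P ^ Suc N"
    by (simp add: x2[symmetric] power2_eq_square flip: power_mult)
  finally have ww: "w * w' = P ^ Suc N" .
  have g1: "signed_gf s (Suc N) = signed_gf s N + w * signed_gf (- s) (Suc N)"
    using signed_gf_Suc[of s N] unfolding w_def x_def .
  have g2: "signed_gf (- s) (Suc N) = signed_gf (- s) N + w' * signed_gf s (Suc N)"
    using signed_gf_Suc[of "- s" N] unfolding w'_def xm minus_minus .
  have "(1 - P ^ Suc N) * signed_gf s (Suc N) = signed_gf s (Suc N) - w * (w' * signed_gf s (Suc N))"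
    unfolding ww[symmetric] by (simp only: left_diff_distrib mult_1_left mult.assoc)
  also have "w * (w' * signed_gf s (Suc N)) = w * signed_gf (- s) (Suc N) - w * signed_gf (- s) N"
    using g2 by (simp add: algebra_simps)
  also have "signed_gf s (Suc N) - \<dots> = signed_gf s N + w * signed_gf (- s) N"
    using g1 by (simp add: algebra_simps)
  finally have "qfact P (Suc N) * signed_gf s (Suc N)
    = qfact P N * signed_gf s N + w * (qfact P N * signed_gf (- s) N)"
    by (simp only: qfact_Suc mult.assoc) (simp add: algebra_simps)
  also have "\<dots> = core_poly P x N + w * core_poly P (- x) N"
    using Suc.IH[of s] Suc.IH[of "- s"] Suc.prems unfolding P_def[symmetric] x_def[symmetric] xm by simp
  also have "\<dots> = core_poly P x (Suc N)"
    using core_poly_Suc[of x N] unfolding x2 w by simp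
  finally show ?case by (simp only: P_def x_def)
qed

section \<open>Comparison with the product\<close>

text \<open>Odd powers of \<open>- x\<^sup>2\<close> give the factors with a plus sign, even powers
  those of \<open>qfact (x ^ 4) M\<close>.\<close>

lemma qfact_minus_square:
  "qfact (- x\<^sup>2) (2 * M) = qfact (x ^ 4) M * (\<Prod>i<M. 1 + x ^ (4 * i + 2))"
proof (induction M)
  case 0
  show ?case by (simp add: qfact_def)
next
  case (Suc M)
  have 1: "(- x\<^sup>2) ^ Suc (2 * M) = - (x ^ (4 * M + 2))"
  proof -
    have "4 * M + 2 = 2 * Suc (2 * M)" by simp
    then show ?thesis
      by (simp only: power_mult) (rule power_minus_odd, simp)
  qed
  have 2: "(- x\<^sup>2) ^ Suc (Suc (2 * M)) = (x ^ 4) ^ Suc M"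
  proof -
    have "(x ^ 4) ^ Suc M = x ^ (2 * Suc (Suc (2 * M)))"
      unfolding power_mult[symmetric] by (rule arg_cong[of _ _ "power x"]) simp
    then show ?thesis
      unfolding power_mult by (subst power_minus_even) simp_all
  qed
  have "2 * Suc M = Suc (Suc (2 * M))" by simp
  then show ?case
    by (simp only: qfact_Suc Suc.IH 1 2 prod.lessThan_Suc) (simp add: algebra_simps)
qed

lemma gf_factor_mult:
  "gf_factor (Suc i) * ((1 - (fps_X ^ 4) ^ Suc i) * (1 + fps_X ^ (4 * i + 2)) ^ 2) = 1 + fps_X ^ (2 * i + 1)"
proof -
  let ?D = "(1 - (fps_X ^ 4) ^ Suc i) * (1 + fps_X ^ (4 * i + 2)) ^ 2 :: rat fps"
  have "gf_factor (Suc i) = (1 + fps_X ^ (2 * i + 1)) / ?D"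
    unfolding gf_factor_def power_mult[symmetric] by simp
  moreover have "fps_nth ?D 0 \<noteq> 0"
    by (simp add: power2_eq_square fps_X_power_iff)
  ultimately show ?thesis
    by (simp add: fps_divide_unit inverse_mult_eq_1 mult.assoc)
qed

lemma prod_gf_factor_mult:
  "(\<Prod>i<M. gf_factor (Suc i)) * (qfact (fps_X ^ 4) M * (\<Prod>i<M. 1 + fps_X ^ (4 * i + 2)) ^ 2)
     = (\<Prod>i<M. 1 + fps_X ^ (2 * i + 1))"
  unfolding qfact_def prod_power_distrib prod.distrib[symmetric] gf_factor_mult ..

text \<open>Both sides are multiplied by \<open>U * (U * V\<^sup>2)\<close>, the square of
  \<open>qfact P (2 * M)\<close>. One copy of \<open>qfact P (2 * M)\<close> turns the partition
  series into \<open>core_poly\<close>, the other pays for the change of base.\<close>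

lemma fps_cong_signed_gf:
  "fps_cong M (signed_gf 1 (2 * M)) (\<Prod>i<M. gf_factor (Suc i))"
proof -
  define P :: "rat fps" where "P = - fps_X\<^sup>2"
  define Q :: "rat fps" where "Q = fps_X ^ 4"
  define U where "U = qfact Q M"
  define V :: "rat fps" where "V = (\<Prod>i<M. 1 + fps_X ^ (4 * i + 2))"
  define W :: "nat \<Rightarrow> rat fps" where "W K = (\<Prod>i<K. 1 + fps_X ^ (2 * i + 1))" for K
  define G where "G = (\<Prod>i<M. gf_factor (Suc i))"
  have P0: "fps_nth P 0 = 0" and Q0: "fps_nth Q 0 = 0"
    by (simp_all add: P_def Q_def)
  have UV: "qfact P (2 * M) = U * V"
    unfolding P_def U_def V_def Q_def by (rule qfact_minus_square)
  have nz: "fps_nth (U * (U * V\<^sup>2)) 0 \<noteq> 0"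
  proof -
    have "fps_nth U 0 = 1" "fps_nth (U * V) 0 = 1"
      by (simp_all only: U_def UV[symmetric, unfolded U_def] fps_nth_qfact_0[OF P0] fps_nth_qfact_0[OF Q0])
    then show ?thesis by (simp add: power2_eq_square)
  qed
  have W: "fps_cong M (W (2 * M)) (W M)"
    unfolding W_def by (rule fps_cong_prod_lessThan) (auto simp: fps_cong_def fps_X_power_iff simp del: power_Suc)
  have "U * (U * V\<^sup>2) * signed_gf 1 (2 * M) = qfact P (2 * M) * (qfact P (2 * M) * signed_gf 1 (2 * M))"
    unfolding UV by (simp add: power2_eq_square mult_ac)
  also have "qfact P (2 * M) * signed_gf 1 (2 * M) = core_poly P fps_X (2 * M)"
    using qfact_mult_signed_gf[of 1 "2 * M"] by (simp add: P_def)
  also have "fps_cong M (qfact P (2 * M) * core_poly P fps_X (2 * M)) (qfact P M * core_poly P fps_X (2 * M))"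
    by (intro fps_cong_mult fps_cong_refl fps_cong_qfact P0) auto
  \<comment> \<open>The change of base: both sides are congruent to the same sum of powers over core
    sizes.\<close>
  also have "fps_cong M \<dots> (U * core_poly Q fps_X (2 * M))"
    unfolding U_def using fps_cong_core_poly[OF P0] fps_cong_core_poly[OF Q0]
    by (blast intro: fps_cong_trans fps_cong_sym)
  also have "core_poly Q fps_X (2 * M) = W (2 * M)"
    unfolding Q_def W_def by (rule core_poly_triple_product)
  also have "fps_cong M (U * W (2 * M)) (U * W M)"
    by (intro fps_cong_mult fps_cong_refl W)
  also have "U * W M = U * (U * V\<^sup>2) * G"
    using prod_gf_factor_mult[of M] by (simp add: W_def U_def V_def Q_def G_def mult_ac)
  finally show ?thesis
    unfolding G_def[symmetric] by (rule fps_cong_cancel[OF _ nz])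
qed

lemma fps_nth_signed_gf:
  assumes "n \<le> N"
  shows "fps_nth (signed_gf 1 N) n =
    of_int (int (card {xs. partition_of xs n \<and> even (num_even_hooks xs)})
      - int (card {xs. partition_of xs n \<and> odd (num_even_hooks xs)}))"
proof -
  let ?A = "{xs. partition_of xs n \<and> even (num_even_hooks xs)}"
  let ?B = "{xs. partition_of xs n \<and> odd (num_even_hooks xs)}"
  have fin: "finite ?A" "finite ?B"
    by (auto intro: finite_subset[OF _ finite_partitions[of n]])
  have iff: "even (hook_stat xs) \<longleftrightarrow> even (num_even_hooks xs)" if "partition_of xs n" for xs
    using that even_num_even_hooks_iff by (auto simp: partition_of_def)
  have union: "{xs. partition_of xs n} = ?A \<union> ?B" by auto
  have "fps_nth (signed_gf 1 N) n = (\<Sum>xs | partition_of xs n. (- 1) ^ hook_stat xs)"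
    by (simp add: signed_gf_def bounded_partitions_eq[OF assms])
  also have "\<dots> = (\<Sum>xs\<in>?A \<union> ?B. (- 1) ^ hook_stat xs)"
    unfolding union ..
  also have "\<dots> = (\<Sum>xs\<in>?A. (- 1) ^ hook_stat xs) + (\<Sum>xs\<in>?B. (- 1) ^ hook_stat xs)"
    by (rule sum.union_disjoint[OF fin]) auto
  also have "(\<Sum>xs\<in>?A. (- 1 :: rat) ^ hook_stat xs) = (\<Sum>xs\<in>?A. 1)"
    using iff by (intro sum.cong) auto
  also have "(\<Sum>xs\<in>?B. (- 1 :: rat) ^ hook_stat xs) = (\<Sum>xs\<in>?B. - 1)"
    using iff by (intro sum.cong) auto
  finally show ?thesis by simp
qed

section \<open>Passage to the infinite product\<close>

theorem theorem3p4:
  fixes f :: "nat \<Rightarrow> int" and n :: nat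
  assumes "(\<lambda>k. gf_factor (k + 1)) has_prod Abs_fps (\<lambda>m. of_int (f m))"
  shows "f n = int (card {xs. partition_of xs n \<and> even (num_even_hooks xs)})
             - int (card {xs. partition_of xs n \<and> odd (num_even_hooks xs)})"
proof -
  \<comment> \<open>\<open>has_prod\<close> also admits products with a vanishing factor; excluding
    these makes the given series the limit of the full partial products.\<close>
  have "gf_factor (k + 1) \<noteq> 0" for k
  proof
    assume "gf_factor (k + 1) = 0"
    then have "1 + fps_X ^ (2 * k + 1) = (0 :: rat fps)"
      using gf_factor_mult[of k] by simp
    then have "fps_nth (1 + fps_X ^ (2 * k + 1) :: rat fps) 0 = 0"
      by simp
    then show False by simp
  qed
  then have "(\<lambda>n. \<Prod>k\<le>n. gf_factor (k + 1)) \<longlonglongrightarrow> Abs_fps (\<lambda>m. of_int (f m))"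
    using assms by (auto simp: has_prod_def raw_has_prod_def)
  \<comment> \<open>Convergence of power series means that each coefficient is eventually constant,
    so one large \<open>M\<close> suffices for the coefficient at \<open>n\<close>.\<close>
  then have "\<forall>\<^sub>F M in sequentially. fps_nth (\<Prod>k\<le>M. gf_factor (k + 1)) n = of_int (f n)"
    unfolding tendsto_fps_iff by simp
  then have "\<forall>\<^sub>F M in sequentially. n \<le> M \<and> fps_nth (\<Prod>k\<le>M. gf_factor (k + 1)) n = of_int (f n)"
    using eventually_ge_at_top[of n] by (rule eventually_conj[rotated])
  then obtain M where M: "n \<le> M" "fps_nth (\<Prod>k\<le>M. gf_factor (k + 1)) n = of_int (f n)"
    using eventually_happens by force
  have "of_int (f n) = fps_nth (\<Prod>k<Suc M. gf_factor (Suc k)) n"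
    using M(2) by (simp add: lessThan_Suc_atMost)
  also have "\<dots> = fps_nth (signed_gf 1 (2 * Suc M)) n"
    using fps_cong_signed_gf[of "Suc M"] M(1) unfolding fps_cong_def by (metis le_SucI)
  also have "n \<le> 2 * Suc M"
    using M(1) by simp
  note fps_nth_signed_gf[OF this]
  finally show ?thesis
    by (simp only: of_int_eq_iff)
qed

end
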